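(* Let $\mathcal{M}=(E,\mathcal{C})$ be a Lawrence oriented matroid of rank $r$, let $e\in E$, and let $B,B'$ be $e$-embracing bases of $\mathcal{M}$. Then $d_e(B,B')\leq r$.
   Context: Given a matrix $A=(a_{i,j})\in\{+1,-1\}^{r\times n}$, the Lawrence oriented matroid $\mathcal{M}_A$ is the oriented matroid on $E=[n]=\{1,\dots,n\}$ whose underlying matroid is uniform of rank $r$ (so the circuit supports are exactly the $(r+1)$-subsets of $[n]$) and whose signed circuits $X$ with support $\{x_1<\cdots<x_{r+1}\}$ are determined, up to global sign, by $X_{x_i}=X_{x_{i+1}} \Longleftrightarrow a_{i,x_i}=-a_{i,x_{i+1}}$ for $i=1,\dots,r$. A Lawrence oriented matroid of rank $r$ is one of the form $\mathcal{M}_A$. For an oriented matroid with circuit set $\mathcal{C}$ on $E$: $\underline{X}$ denotes the support of $X$; a circuit $X\in\mathcal{C}$ is positive if $X(f)\in\{0,+\}$ for all $f\in E$; $\mathcal{C}_e^+$ is the set of positive circuits $X$ with $X(e)=+$. For a basis $B$ (of the underlying matroid) with $e\notin B$, the fundamental circuit $C(B,e)$ is the unique $X\in\mathcal{C}$ with $\underline{X}\subseteq B\cup\{e\}$ and $X(e)=+$. The basis $B$ (with $e\notin B$) is $e$-embracing if $C(B,e)\in\mathcal{C}_e^+$. The $e$-embracing distance $d_e(B,B')$ of two $e$-embracing bases is the minimum $k$ such that there is a sequence $B=B_0,B_1,\ldots,B_k=B'$ of $e$-embracing bases with $|B_{i-1}\Delta B_i|=2$ for all $i\in\{1,\dots,k\}$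 ($\infty$ if there is none). *)

theory Defs
  imports Main "HOL-Library.Extended_Nat"
begin

section \<open>Signed circuits, bases and embracing\<close>

text \<open>
  A signed subset is a function \<open>X\<close> with values in \<open>{-1, 0, 1}\<close>; an oriented matroid on \<open>E\<close> is
  given by its set \<open>C\<close> of signed circuits. The notions in this section are stated for an
  arbitrary set \<open>C\<close> of signed subsets of \<open>E\<close>.
\<close>

definition signed_subset :: "'a set \<Rightarrow> ('a \<Rightarrow> int) \<Rightarrow> bool" where
  "signed_subset E X \<longleftrightarrow> (\<forall>f. X f \<in> {-1, 0, 1}) \<and> (\<forall>f. f \<notin> E \<longrightarrow> X f = 0)"

definition supp :: "('a \<Rightarrow> int) \<Rightarrow> 'a set" where
  "supp X = {f. X f \<noteq> 0}"

definition indep_set :: "'a set \<Rightarrow> ('a \<Rightarrow> int) set \<Rightarrow> 'a set \<Rightarrow> bool" where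
  "indep_set E C I \<longleftrightarrow> I \<subseteq> E \<and> (\<forall>X\<in>C. \<not> supp X \<subseteq> I)"

definition is_basis :: "'a set \<Rightarrow> ('a \<Rightarrow> int) set \<Rightarrow> 'a set \<Rightarrow> bool" where
  "is_basis E C B \<longleftrightarrow> indep_set E C B \<and> (\<forall>I. indep_set E C I \<longrightarrow> B \<subseteq> I \<longrightarrow> I = B)"

definition positive_circuits_at :: "'a set \<Rightarrow> ('a \<Rightarrow> int) set \<Rightarrow> 'a \<Rightarrow> ('a \<Rightarrow> int) set" where
  "positive_circuits_at E C e = {X \<in> C. (\<forall>f\<in>E. X f \<in> {0, 1}) \<and> X e = 1}"

definition fundamental_circuit :: "('a \<Rightarrow> int) set \<Rightarrow> 'a set \<Rightarrow> 'a \<Rightarrow> ('a \<Rightarrow> int)" where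
  "fundamental_circuit C B e = (THE X. X \<in> C \<and> supp X \<subseteq> B \<union> {e} \<and> X e = 1)"

definition embracing :: "'a set \<Rightarrow> ('a \<Rightarrow> int) set \<Rightarrow> 'a \<Rightarrow> 'a set \<Rightarrow> bool" where
  "embracing E C e B \<longleftrightarrow>
     is_basis E C B \<and> e \<notin> B \<and> fundamental_circuit C B e \<in> positive_circuits_at E C e"

definition embracing_path ::
    "'a set \<Rightarrow> ('a \<Rightarrow> int) set \<Rightarrow> 'a \<Rightarrow> 'a set \<Rightarrow> 'a set \<Rightarrow> nat \<Rightarrow> bool" where
  "embracing_path E C e B B' k \<longleftrightarrow>
     (\<exists>S :: nat \<Rightarrow> 'a set. S 0 = B \<and> S k = B' \<and> (\<forall>i\<le>k. embracing E C e (S i)) \<and>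
        (\<forall>i\<in>{1..k}. card (sym_diff (S (i - 1)) (S i)) = 2))"

text \<open>The infimum of the empty set in \<^typ>\<open>enat\<close> is \<open>\<infinity>\<close>.\<close>

definition embracing_dist ::
    "'a set \<Rightarrow> ('a \<Rightarrow> int) set \<Rightarrow> 'a \<Rightarrow> 'a set \<Rightarrow> 'a set \<Rightarrow> enat" where
  "embracing_dist E C e B B' = Inf {enat k | k. embracing_path E C e B B' k}"


section \<open>Lawrence oriented matroids\<close>

text \<open>
  Matrices are 1-indexed, with only the entries \<open>A i j\<close> for \<open>i \<in> {1..r}\<close>, \<open>j \<in> {1..n}\<close> relevant.
  The function \<open>x\<close> is the increasing enumeration \<open>x 1 < \<dots> < x (r + 1)\<close> of the support.
\<close>

definition sign_matrix :: "nat \<Rightarrow> nat \<Rightarrow> (nat \<Rightarrow> nat \<Rightarrow> int) \<Rightarrow> bool" where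
  "sign_matrix r n A \<longleftrightarrow> (\<forall>i\<in>{1..r}. \<forall>j\<in>{1..n}. A i j \<in> {1, -1})"

definition lawrence_circuits :: "nat \<Rightarrow> nat \<Rightarrow> (nat \<Rightarrow> nat \<Rightarrow> int) \<Rightarrow> (nat \<Rightarrow> int) set" where
  "lawrence_circuits r n A =
     {X. signed_subset {1..n} X \<and>
         (\<exists>x :: nat \<Rightarrow> nat. strict_mono_on {1..r + 1} x \<and> supp X = x ` {1..r + 1} \<and>
            (\<forall>i\<in>{1..r}. X (x i) = X (x (i + 1)) \<longleftrightarrow> A i (x i) = - A i (x (i + 1))))}"

definition lawrence_oriented_matroid :: "nat \<Rightarrow> nat set \<Rightarrow> (nat \<Rightarrow> int) set \<Rightarrow> bool" where
  "lawrence_oriented_matroid r E C \<longleftrightarrow>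
     (\<exists>n A. r \<le> n \<and> sign_matrix r n A \<and> E = {1..n} \<and> C = lawrence_circuits r n A)"


section \<open>Well-definedness\<close>

text \<open>
  The underlying matroid is uniform of rank \<open>r\<close>, and each \<open>(r + 1)\<close>-set supports exactly one
  circuit with prescribed sign at one of its elements, so that the description in
  \<^const>\<open>fundamental_circuit\<close> is proper.
\<close>

lemma enumeration_unique:
  fixes x y :: "nat \<Rightarrow> nat"
  assumes "strict_mono_on {1..m} x" "strict_mono_on {1..m} y" "x ` {1..m} = y ` {1..m}"
    and "i \<in> {1..m}"
  shows "x i = y i"
proof -
  have s: "sorted_wrt (<) (map z [1..<m + 1])" if "strict_mono_on {1..m} z" for z :: "nat \<Rightarrow> nat"
    using that by (auto simp: sorted_wrt_iff_nth_less strict_mono_on_def simp del: upt_Suc)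
  have "{1..<m + 1} = {1..m}" by auto
  then have "map x [1..<m + 1] = map y [1..<m + 1]"
    using s[OF assms(1)] s[OF assms(2)] assms(3)
    by (intro strict_sorted_equal) (simp_all del: upt_Suc)
  then show ?thesis using assms(4) by (auto simp del: upt_Suc)
qed

lemma enumeration_exists:
  fixes S :: "nat set"
  assumes "finite S" "card S = m"
  obtains x where "strict_mono_on {1..m} x" "x ` {1..m} = S"
proof -
  let ?l = "sorted_list_of_set S"
  define x where "x i = ?l ! (i - 1)" for i
  have len: "length ?l = m" using assms by simp
  have mono: "strict_mono_on {1..m} x"
    unfolding strict_mono_on_def x_def
    using sorted_wrt_nth_less[OF strict_sorted_list_of_set[of S]] len by auto
  have "x ` {1..m} = (!) ?l ` {0..<m}"
  proof -
    have "{0..<m} = (\<lambda>i. i - 1) ` {1..m}"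
      by (force simp: image_iff intro: bexI[of _ "Suc _"])
    then show ?thesis by (simp add: x_def image_image)
  qed
  moreover have "(!) ?l ` {0..<m} = set ?l"
    unfolding set_conv_nth len by auto
  ultimately have "x ` {1..m} = S" using assms(1) by simp
  with mono show ?thesis using that by blast
qed

lemma lawrence_circuit_ex1:
  assumes "S \<subseteq> {1..n}" "card S = r + 1" "e \<in> S"
  shows "\<exists>!X. X \<in> lawrence_circuits r n A \<and> supp X = S \<and> X e = 1"
proof -
  have fin: "finite S" using assms(1) finite_subset by blast
  obtain x where x: "strict_mono_on {1..r + 1} x" "x ` {1..r + 1} = S"
    using enumeration_exists[OF fin assms(2)] by blast
  have inj: "inj_on x {1..r + 1}" using x(1) by (rule strict_mono_on_imp_inj_on)
  define y where "y = the_inv_into {1..r + 1} x"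
  have y: "y (x i) = i" if "i \<in> {1..r + 1}" for i
    using the_inv_into_f_f[OF inj that] by (simp add: y_def)
  define s :: "nat \<Rightarrow> int" where
    "s i = (\<Prod>j\<in>{1..<i}. if A j (x j) = - A j (x (j + 1)) then 1 else -1)" for i
  have s_sq: "s i = 1 \<or> s i = -1" for i
    unfolding s_def by (induction i) (auto simp: prod.op_ivl_Suc)
  have s_step: "s i = s (i + 1) \<longleftrightarrow> A i (x i) = - A i (x (i + 1))" if "i \<in> {1..r}" for i
  proof -
    have "s (i + 1) = s i * (if A i (x i) = - A i (x (i + 1)) then 1 else -1)"
      using that by (simp add: s_def prod.op_ivl_Suc)
    then show ?thesis using s_sq[of i] by auto
  qed
  define X where "X f = (if f \<in> S then s (y e) * s (y f) else 0)" for f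
  have sg: "X f \<in> {-1, 0, 1}" for f
    using s_sq[of "y e"] s_sq[of "y f"] by (auto simp: X_def)
  have sX: "supp X = S"
  proof -
    have "s i \<noteq> 0" for i using s_sq[of i] by auto
    then show ?thesis by (auto simp: supp_def X_def)
  qed
  have Xe: "X e = 1" using s_sq[of "y e"] assms(3) by (auto simp: X_def)
  have Xx: "X (x i) = s (y e) * s i" if "i \<in> {1..r + 1}" for i
    using y[OF that] that x(2) by (auto simp: X_def)
  have "X \<in> lawrence_circuits r n A"
    unfolding lawrence_circuits_def signed_subset_def
  proof (intro CollectI conjI allI impI exI[of _ x] ballI)
    fix i assume i: "i \<in> {1..r}"
    then have "X (x i) = s (y e) * s i" "X (x (i + 1)) = s (y e) * s (i + 1)"
      using Xx[of i] Xx[of "i + 1"] by auto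
    then show "X (x i) = X (x (i + 1)) \<longleftrightarrow> A i (x i) = - A i (x (i + 1))"
      using s_step[OF i] s_sq[of "y e"] by auto
  qed (use sg sX x assms(1) in \<open>auto simp: X_def\<close>)
  moreover have "Z = Y"
    if Z: "Z \<in> lawrence_circuits r n A" "supp Z = S" "Z e = 1"
      and Y: "Y \<in> lawrence_circuits r n A" "supp Y = S" "Y e = 1" for Z Y
  proof -
    have step: "W (x i) = W (x (i + 1)) \<longleftrightarrow> A i (x i) = - A i (x (i + 1))"
      if "W \<in> lawrence_circuits r n A" "supp W = S" "i \<in> {1..r}" for W i
    proof -
      obtain w where w: "strict_mono_on {1..r + 1} w" "S = w ` {1..r + 1}"
        and h: "\<forall>i\<in>{1..r}. W (w i) = W (w (i + 1)) \<longleftrightarrow> A i (w i) = - A i (w (i + 1))"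
        using \<open>W \<in> _\<close> \<open>supp W = S\<close> unfolding lawrence_circuits_def by blast
      have "w j = x j" if "j \<in> {1..r + 1}" for j
        using enumeration_unique[OF w(1) x(1)] w(2) x(2) that by metis
      then show ?thesis using h \<open>i \<in> {1..r}\<close> by force
    qed
    have pm: "W f = 1 \<or> W f = -1"
      if "W \<in> lawrence_circuits r n A" "supp W = S" "f \<in> S" for W f
      using that by (auto simp: lawrence_circuits_def signed_subset_def supp_def)
    have xS: "x i \<in> S" if "i \<in> {1..r + 1}" for i using x(2) that by blast
    have prp: "Z (x i) = Y (x i) \<longleftrightarrow> Z (x (i + 1)) = Y (x (i + 1))" if i: "i \<in> {1..r}" for i
    proof -
      have "i \<in> {1..r + 1}" "i + 1 \<in> {1..r + 1}" using i by auto
      then have "Z (x i) = 1 \<or> Z (x i) = -1" "Z (x (i + 1)) = 1 \<or> Z (x (i + 1)) = -1"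
        "Y (x i) = 1 \<or> Y (x i) = -1" "Y (x (i + 1)) = 1 \<or> Y (x (i + 1)) = -1"
        by (simp_all only: pm[OF Z(1,2) xS] pm[OF Y(1,2) xS])
      moreover have "Z (x i) = Z (x (i + 1)) \<longleftrightarrow> Y (x i) = Y (x (i + 1))"
        using step[OF Z(1,2) i] step[OF Y(1,2) i] by blast
      ultimately show ?thesis by linarith
    qed
    have all: "Z (x (Suc i)) = Y (x (Suc i)) \<longleftrightarrow> Z (x 1) = Y (x 1)" if "i \<le> r" for i
      using that
    proof (induction i)
      case (Suc i)
      then show ?case using prp[of "Suc i"] by auto
    qed simp
    obtain k where k: "k \<in> {1..r + 1}" "e = x k" using assms(3) x(2) by blast
    have eq: "Z (x 1) = Y (x 1)" using all[of "k - 1"] k Z(3) Y(3) by auto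
    have "Z f = Y f" for f
    proof (cases "f \<in> S")
      case True
      then obtain i where "i \<in> {1..r + 1}" "f = x i" using x(2) by blast
      then show ?thesis using all[of "i - 1"] eq by auto
    next
      case False
      then have "f \<notin> supp Z" "f \<notin> supp Y" using Z(2) Y(2) by simp_all
      then show ?thesis by (simp add: supp_def)
    qed
    then show ?thesis by (rule ext)
  qed
  ultimately show ?thesis using sX Xe by (intro ex1I[of _ X]) simp_all
qed

lemma lawrence_circuit_supports:
  "supp ` lawrence_circuits r n A = {S. S \<subseteq> {1..n} \<and> card S = r + 1}"
proof (intro equalityI subsetI)
  fix S assume "S \<in> supp ` lawrence_circuits r n A"
  then obtain X x where X: "S = supp X" "signed_subset {1..n} X"
    "strict_mono_on {1..r + 1} x" "supp X = x ` {1..r + 1}"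
    by (auto simp: lawrence_circuits_def)
  then have "card S = r + 1"
    using card_image[OF strict_mono_on_imp_inj_on[OF X(3)]] by simp
  moreover have "S \<subseteq> {1..n}" using X(1,2) by (force simp: signed_subset_def supp_def)
  ultimately show "S \<in> {S. S \<subseteq> {1..n} \<and> card S = r + 1}" by blast
next
  fix S assume S: "S \<in> {S. S \<subseteq> {1..n} \<and> card S = r + 1}"
  then obtain e where e: "e \<in> S" by (cases "S = {}") auto
  then show "S \<in> supp ` lawrence_circuits r n A"
    using lawrence_circuit_ex1[of S n r e A] S by (metis (mono_tags, lifting) imageI mem_Collect_eq)
qed

lemma lawrence_indep_iff:
  "indep_set {1..n} (lawrence_circuits r n A) I \<longleftrightarrow> I \<subseteq> {1..n} \<and> card I \<le> r"
proof -
  have "(\<exists>X\<in>lawrence_circuits r n A. supp X \<subseteq> I) \<longleftrightarrow> r + 1 \<le> card I" if I: "I \<subseteq> {1..n}"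
  proof -
    have fin: "finite I" using I finite_subset by blast
    have "(\<exists>X\<in>lawrence_circuits r n A. supp X \<subseteq> I) \<longleftrightarrow>
        (\<exists>S\<in>supp ` lawrence_circuits r n A. S \<subseteq> I)" by blast
    also have "\<dots> \<longleftrightarrow> (\<exists>S. S \<subseteq> I \<and> card S = r + 1)"
      unfolding lawrence_circuit_supports using I by blast
    also have "\<dots> \<longleftrightarrow> r + 1 \<le> card I"
      by (metis card_mono fin obtain_subset_with_card_n)
    finally show ?thesis .
  qed
  then show ?thesis unfolding indep_set_def by fastforce
qed

lemma lawrence_basis_iff:
  assumes "r \<le> n"
  shows "is_basis {1..n} (lawrence_circuits r n A) B \<longleftrightarrow> B \<subseteq> {1..n} \<and> card B = r"
proof
  assume B: "is_basis {1..n} (lawrence_circuits r n A) B"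
  then have B1: "B \<subseteq> {1..n}" "card B \<le> r"
    unfolding is_basis_def lawrence_indep_iff by blast+
  obtain I where I: "B \<subseteq> I" "I \<subseteq> {1..n}" "card I = r"
    using exists_subset_between[of B r "{1..n}"] B1 assms by auto
  then have "I = B" using B unfolding is_basis_def lawrence_indep_iff by simp
  then show "B \<subseteq> {1..n} \<and> card B = r" using I by blast
next
  assume B: "B \<subseteq> {1..n} \<and> card B = r"
  have "I = B" if "I \<subseteq> {1..n}" "card I \<le> r" "B \<subseteq> I" for I
    using B that card_seteq[of I B] finite_subset[of I "{1..n}"] by auto
  then show "is_basis {1..n} (lawrence_circuits r n A) B"
    using B unfolding is_basis_def lawrence_indep_iff by blast
qed

lemma lawrence_fundamental_circuit_ex1:
  assumes "r \<le> n" "is_basis {1..n} (lawrence_circuits r n A) B" "e \<in> {1..n}" "e \<notin> B"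
  shows "\<exists>!X. X \<in> lawrence_circuits r n A \<and> supp X \<subseteq> B \<union> {e} \<and> X e = 1"
proof -
  have B: "B \<subseteq> {1..n}" "card B = r" using assms(2) lawrence_basis_iff[OF assms(1)] by blast+
  have fin: "finite B" using B(1) finite_subset by blast
  have c: "card (B \<union> {e}) = r + 1" using B(2) fin assms(4) by simp
  have "supp X \<subseteq> B \<union> {e} \<longleftrightarrow> supp X = B \<union> {e}" if "X \<in> lawrence_circuits r n A" for X
  proof -
    have "card (supp X) = r + 1" using that lawrence_circuit_supports[of r n A] by blast
    then show ?thesis using card_subset_eq[of "B \<union> {e}" "supp X"] fin c by auto
  qed
  then have "X \<in> lawrence_circuits r n A \<and> supp X \<subseteq> B \<union> {e} \<and> X e = 1 \<longleftrightarrow>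
      X \<in> lawrence_circuits r n A \<and> supp X = B \<union> {e} \<and> X e = 1" for X
    by (intro conj_cong refl) simp_all
  moreover have "\<exists>!X. X \<in> lawrence_circuits r n A \<and> supp X = B \<union> {e} \<and> X e = 1"
    using B(1) assms(3) c by (intro lawrence_circuit_ex1) auto
  ultimately show ?thesis by simp
qed

end

theory Submission
  imports Defs
begin

text \<open>
  Let \<open>S = {x\<^sub>1 < \<dots> < x\<^sub>r\<^sub>+\<^sub>1}\<close> contain \<open>e = x\<^sub>p\<close>. The basis \<open>S - {e}\<close> is \<open>e\<close>-embracing iff
  row \<open>i\<close> takes different signs at \<open>x\<^sub>i\<close> and \<open>x\<^sub>i\<^sub>+\<^sub>1\<close> for every \<open>i\<close>. Cutting at \<open>e\<close> splits this
  condition into two independent ones: walking from \<open>e\<close> to the right, the rows \<open>p, \<dots>, r\<close> must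
  alternate one after the other, and walking to the left the rows \<open>p - 1, \<dots>, 1\<close> must do so. Such
  a walk is called an arm of \<open>e\<close> below; an embracing basis is a left arm together with a right
  arm whose row lists are complementary.

  Everything rests on one exchange property (\<open>arm_slide\<close>): if the starting point \<open>y\<close> of an arm is
  replaced by an earlier starting point \<open>x\<close>, then the arm from \<open>y\<close> together with \<open>y\<close> itself
  becomes an arm from \<open>x\<close> for the same rows once a suitable single point is deleted. It has two
  consequences.

  First, two arms of \<open>e\<close> for the same \<open>m\<close> rows are at distance at most \<open>m\<close> (\<open>arm_within\<close>): the
  nearer of the two first points can be exchanged into the other arm in one step, after which both
  arms continue from the same point with \<open>m - 1\<close> rows.

  Second, deleting one suitable point from an arm gives an arm that skips the first row
  (\<open>arm_drop\<close>). So a right arm can give up a row to a left arm: one point on the right disappears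
  and one on the left appears, which is a single basis exchange (\<open>shift_within\<close>).

  If \<open>e\<close> is in position \<open>p\<close> of the first circuit and in position \<open>q \<ge> p\<close> of the second, shorten
  the left arm of the second by \<open>q - p\<close> rows and move the left arm of the first to it
  (\<open>p - 1\<close> steps), then hand \<open>q - p\<close> rows over from right to left (\<open>q - p\<close> steps), then adjust the
  right arm (\<open>r + 1 - q\<close> steps). The total is \<open>r\<close>.
\<close>

section \<open>Bounded exchange distance\<close>

text \<open>
  The bound \<open>k\<close> is only an upper bound on the number of exchanges, so that steps that happen to be
  trivial need no separate count.
\<close>

inductive exchange_within :: "('a set \<Rightarrow> bool) \<Rightarrow> nat \<Rightarrow> 'a set \<Rightarrow> 'a set \<Rightarrow> bool" for P where
  refl: "P S \<Longrightarrow> exchange_within P k S S"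
| step: "exchange_within P k S T \<Longrightarrow> P U \<Longrightarrow> card (sym_diff T U) = 2 \<Longrightarrow> exchange_within P (Suc k) S U"

lemma exchange_within_ends: "exchange_within P k S T \<Longrightarrow> P S \<and> P T"
  by (induction rule: exchange_within.induct) auto

lemma exchange_within_trans:
  assumes "exchange_within P l T U" "exchange_within P k S T"
  shows "exchange_within P (k + l) S U"
  using assms
proof (induction rule: exchange_within.induct)
  case (refl T l)
  from refl(2) show ?case
  proof (induction rule: exchange_within.induct)
    case (step k S T U)
    then show ?case using exchange_within.step[of P "k + l" S T U] by simp
  qed (rule exchange_within.refl)
next
  case (step l T U V)
  then show ?case using exchange_within.step[of P "k + l" S U V] by simp
qed

lemma exchange_within_single: "P S \<Longrightarrow> P T \<Longrightarrow> card (sym_diff S T) = 2 \<Longrightarrow> exchange_within P 1 S T"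
  using exchange_within.step[OF exchange_within.refl, of P S T 0] by simp

lemma exchange_within_sym: "exchange_within P k S T \<Longrightarrow> exchange_within P k T S"
proof (induction rule: exchange_within.induct)
  case (step k S T U)
  then have "exchange_within P 1 U T"
    by (intro exchange_within_single) (auto dest: exchange_within_ends simp: Un_commute)
  then show ?case using exchange_within_trans[OF step.IH, of 1 U] by simp
qed (rule exchange_within.refl)

lemma exchange_within_Un:
  assumes "exchange_within P k S T"
    and "\<And>S. P S \<Longrightarrow> S \<inter> D = {}" "\<And>S. P S \<Longrightarrow> Q (S \<union> D)"
  shows "exchange_within Q k (S \<union> D) (T \<union> D)"
  using assms(1)
proof (induction rule: exchange_within.induct)
  case (step k S T U)
  have "T \<inter> D = {}" "U \<inter> D = {}"
    using exchange_within_ends[OF step.hyps(1)] step.hyps(2) assms(2) by auto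
  then have "sym_diff (T \<union> D) (U \<union> D) = sym_diff T U" by blast
  then show ?case using exchange_within.step[OF step.IH] step.hyps assms(3) by simp
qed (rule exchange_within.refl, rule assms(3))

lemma card_sym_diff_exchange:
  "a \<notin> S \<Longrightarrow> b \<notin> S \<Longrightarrow> a \<noteq> b \<Longrightarrow> card (sym_diff (insert a S) (insert b S)) = 2"
proof -
  assume "a \<notin> S" "b \<notin> S" "a \<noteq> b"
  then have "sym_diff (insert a S) (insert b S) = {a, b}" by blast
  then show ?thesis using \<open>a \<noteq> b\<close> by simp
qed

lemma embracing_path_of_exchange_within:
  "exchange_within (embracing E C e) k B B' \<Longrightarrow> \<exists>j\<le>k. embracing_path E C e B B' j"
proof (induction rule: exchange_within.induct)
  case (refl S k)
  then have "embracing_path E C e S S 0" by (auto simp: embracing_path_def)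
  then show ?case by blast
next
  case (step k S T U)
  then obtain j F where j: "j \<le> k" and F: "F 0 = S" "F j = T" "\<forall>i\<le>j. embracing E C e (F i)"
    "\<forall>i\<in>{1..j}. card (sym_diff (F (i - 1)) (F i)) = 2"
    unfolding embracing_path_def by blast
  have "embracing_path E C e S U (Suc j)"
    unfolding embracing_path_def
  proof (intro exI[of _ "F(Suc j := U)"] conjI allI impI ballI)
    fix i assume "i \<in> {1..Suc j}"
    then show "card (sym_diff ((F(Suc j := U)) (i - 1)) ((F(Suc j := U)) i)) = 2"
      using F step.hyps by (cases "i = Suc j") auto
  qed (use F step.hyps in auto)
  then show ?case using j by blast
qed

section \<open>Arms\<close>

text \<open>
  The order is a parameter because left arms are right arms for the reversed order, with the rows
  listed in the order in which they are met when leaving \<open>e\<close>. The set \<open>S\<close> does not contain the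
  starting point.
\<close>

primrec arm :: "('a \<Rightarrow> 'a \<Rightarrow> bool) \<Rightarrow> 'a set \<Rightarrow> ('a \<Rightarrow> 'b) list \<Rightarrow> 'a \<Rightarrow> 'a set \<Rightarrow> bool" where
  "arm lt V [] e S \<longleftrightarrow> S = {}"
| "arm lt V (R # Rs) e S \<longleftrightarrow>
    (\<exists>x T. S = insert x T \<and> x \<in> V \<and> lt e x \<and> R e \<noteq> R x \<and> arm lt V Rs x T)"

lemma arm_beyond:
  "transp lt \<Longrightarrow> arm lt V Rs e S \<Longrightarrow> f \<in> S \<Longrightarrow> lt e f \<and> f \<in> V"
  by (induction Rs arbitrary: e S) (auto dest: transpD)

text \<open>
  Let \<open>R\<close> be the first row. If \<open>R\<close> does not separate \<open>x\<close> from \<open>y\<close>, the arm of \<open>y\<close> is an arm of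
  \<open>x\<close> and \<open>y\<close> is the point to delete. Otherwise \<open>y\<close> itself can serve as the first point after
  \<open>x\<close>, and the same question arises for \<open>y\<close> and the next point with one row fewer; when the rows
  run out, the last point is deleted.
\<close>

lemma arm_slide:
  assumes "transp lt" "irreflp lt"
  shows "lt x y \<Longrightarrow> y \<in> V \<Longrightarrow> arm lt V Rs y S \<Longrightarrow>
    \<exists>z T. arm lt V Rs x T \<and> z \<notin> T \<and> insert y S = insert z T"
proof (induction Rs arbitrary: x y S)
  case (Cons R Rs)
  from Cons.prems(3) obtain w U where w: "S = insert w U" "w \<in> V" "lt y w" "R y \<noteq> R w"
    "arm lt V Rs w U" by auto
  show ?case
  proof (cases "R x = R y")
    case True
    then have "arm lt V (R # Rs) x S" using w Cons.prems(1) assms(1) by (auto dest: transpD)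
    moreover have "y \<notin> S"
      using arm_beyond[OF assms(1) Cons.prems(3)] assms(2) by (auto dest: irreflpD)
    ultimately show ?thesis by blast
  next
    case False
    obtain z T where T: "arm lt V Rs y T" "z \<notin> T" "insert w U = insert z T"
      using Cons.IH[OF w(3,2,5)] by blast
    have "z \<in> S" using T(3) w(1) by auto
    then have "z \<noteq> y" using arm_beyond[OF assms(1) Cons.prems(3)] assms(2) by (auto dest: irreflpD)
    moreover have "arm lt V (R # Rs) x (insert y T)" using T(1) Cons.prems(1,2) False by auto
    ultimately show ?thesis using T(2,3) w(1) by (intro exI[of _ z] exI[of _ "insert y T"]) auto
  qed
qed auto

lemma arm_drop:
  assumes "transp lt" "irreflp lt" "arm lt V (R # Rs) e S"
  shows "\<exists>z T. arm lt V Rs e T \<and> z \<notin> T \<and> S = insert z T"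
  using arm_slide[OF assms(1,2)] assms(3) by fastforce

text \<open>
  If the first point \<open>x\<close> of one arm precedes the first point of the other, sliding the other arm back
  to start from \<open>x\<close> and putting \<open>x\<close> in front is one exchange. Both then begin with \<open>x\<close>, and the
  rest is an instance with \<open>x\<close> in the role of \<open>e\<close>.
\<close>

lemma arm_within:
  fixes lt :: "'a \<Rightarrow> 'a \<Rightarrow> bool"
  assumes lt: "transp lt" "irreflp lt" "totalp lt"
  shows "arm lt V Rs e S \<Longrightarrow> arm lt V Rs e T \<Longrightarrow> exchange_within (arm lt V Rs e) (length Rs) S T"
proof (induction Rs arbitrary: e S T)
  case Nil
  then show ?case by (auto intro: exchange_within.refl)
next
  case (Cons R Rs)
  let ?P = "arm lt V (R # Rs) e"
  have same: "exchange_within ?P (length Rs) (insert x S') (insert x T')"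
    if "x \<in> V" "lt e x" "R e \<noteq> R x" "arm lt V Rs x S'" "arm lt V Rs x T'" for x S' T'
  proof -
    have "exchange_within ?P (length Rs) (S' \<union> {x}) (T' \<union> {x})"
    proof (rule exchange_within_Un[OF Cons.IH[OF that(4,5)]])
      fix U assume "arm lt V Rs x U"
      then show "U \<inter> {x} = {}" "?P (U \<union> {x})"
        using arm_beyond[OF lt(1), of V Rs x U x] irreflpD[OF lt(2), of x] that(1-3) by auto
    qed
    then show ?thesis by simp
  qed
  have earlier: "exchange_within ?P (length (R # Rs)) (insert x S') (insert y T')"
    if x: "x \<in> V" "lt e x" "R e \<noteq> R x" "arm lt V Rs x S'"
      and y: "y \<in> V" "lt e y" "R e \<noteq> R y" "arm lt V Rs y T'" and "lt x y" for x y S' T'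
  proof -
    obtain z U where U: "arm lt V Rs x U" "z \<notin> U" "insert y T' = insert z U"
      using arm_slide[OF lt(1,2) \<open>lt x y\<close> y(1,4)] by blast
    have "lt x f" if "f \<in> insert y T'" for f
      using that arm_beyond[OF lt(1) y(4), of f] \<open>lt x y\<close> transpD[OF lt(1)] by blast
    then have "x \<notin> insert y T'" using irreflpD[OF lt(2)] by blast
    then have "card (sym_diff (insert x U) (insert z U)) = 2"
      using U(2,3) by (intro card_sym_diff_exchange) auto
    moreover have "?P (insert z U)" unfolding U(3)[symmetric] using y by auto
    ultimately show ?thesis
      unfolding U(3) using exchange_within.step[OF same[OF x U(1)]] by simp
  qed
  obtain x S' where x: "S = insert x S'" "x \<in> V" "lt e x" "R e \<noteq> R x" "arm lt V Rs x S'"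
    using Cons.prems(1) by auto
  obtain y T' where y: "T = insert y T'" "y \<in> V" "lt e y" "R e \<noteq> R y" "arm lt V Rs y T'"
    using Cons.prems(2) by auto
  consider "lt x y" | "lt y x" | "x = y" using totalpD[OF lt(3)] by blast
  then show ?case
  proof cases
    case 1
    then show ?thesis using earlier x y by blast
  next
    case 2
    then show ?thesis using exchange_within_sym[OF earlier] x y by blast
  next
    case 3
    then have "exchange_within ?P (length Rs) S T" using same x y by blast
    with exchange_within_trans[OF this exchange_within.refl[of ?P S 1]] show ?thesis
      using Cons.prems(1) by (simp del: arm.simps)
  qed
qed

text \<open>
  A left arm and a right arm of \<open>e\<close> merge into a single right arm that starts at the leftmost
  point; \<open>Ls\<close> is reversed since left arms list their rows from \<open>e\<close> outwards. Joined
  arms can be enumerated from left to right, which is how circuits are described.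
\<close>

lemma arm_join:
  fixes e :: "'a::linorder"
  assumes "arm (>) V Ls e S" "arm (<) V Rs e T" "e \<in> V"
  shows "\<exists>z\<in>V. \<exists>U. arm (<) V (rev Ls @ Rs) z U \<and> insert z U = insert e (S \<union> T)"
  using assms
proof (induction Ls arbitrary: e Rs S T)
  case (Cons L Ls)
  then obtain l S' where l: "S = insert l S'" "l \<in> V" "l < e" "L e \<noteq> L l" "arm (>) V Ls l S'"
    by auto
  then have "arm (<) V (L # Rs) l (insert e T)" using Cons.prems by (auto intro!: exI[of _ e] exI[of _ T])
  from Cons.IH[OF l(5) this l(2)] show ?case using l(1) by (simp add: insert_commute)
qed auto

lemma arm_enumeration:
  "arm lt V Rs e S \<Longrightarrow> \<exists>x. x 0 = e \<and> x ` {..length Rs} = insert e S \<and>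
     (\<forall>i<length Rs. lt (x i) (x (Suc i)) \<and> (Rs ! i) (x i) \<noteq> (Rs ! i) (x (Suc i)))"
proof (induction Rs arbitrary: e S)
  case Nil
  then show ?case by (auto intro: exI[of _ "\<lambda>_. e"])
next
  case (Cons R Rs)
  then obtain y T where y: "S = insert y T" "lt e y" "R e \<noteq> R y" "arm lt V Rs y T" by auto
  from Cons.IH[OF this(4)] obtain x where x: "x 0 = y" "x ` {..length Rs} = insert y T"
    "\<forall>i<length Rs. lt (x i) (x (Suc i)) \<and> (Rs ! i) (x i) \<noteq> (Rs ! i) (x (Suc i))" by blast
  show ?case
  proof (intro exI[of _ "case_nat e x"] conjI allI impI)
    show "case_nat e x ` {..length (R # Rs)} = insert e S"
      using x(2) y(1) by (simp add: atMost_Suc_eq_insert_0 image_image)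
  qed (use x y in \<open>auto split: nat.split simp: less_Suc_eq_0_disj\<close>)
qed

section \<open>Embracing bases as pairs of arms\<close>

abbreviation right_arm :: "nat \<Rightarrow> nat \<Rightarrow> (nat \<Rightarrow> nat \<Rightarrow> int) \<Rightarrow> nat \<Rightarrow> nat \<Rightarrow> nat set \<Rightarrow> bool" where
  "right_arm r n A p \<equiv> arm (<) {1..n} (map A [p..<r + 1])"

abbreviation left_arm :: "nat \<Rightarrow> (nat \<Rightarrow> nat \<Rightarrow> int) \<Rightarrow> nat \<Rightarrow> nat \<Rightarrow> nat set \<Rightarrow> bool" where
  "left_arm n A p \<equiv> arm (>) {1..n} (map A (rev [1..<p]))"

lemma right_arm_enumerated:
  fixes x :: "nat \<Rightarrow> nat"
  assumes "p \<le> m" "x ` {p<..m} \<subseteq> V"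
    and "\<And>i. p \<le> i \<Longrightarrow> i < m \<Longrightarrow> x i < x (i + 1) \<and> A i (x i) \<noteq> A i (x (i + 1))"
  shows "arm (<) V (map A [p..<m]) (x p) (x ` {p<..m})"
  using assms
proof (induction p rule: inc_induct)
  case (step p)
  have "{p<..m} = insert (Suc p) {Suc p<..m}" using step.hyps by auto
  then show ?case using step by (force simp: upt_conv_Cons)
qed simp

lemma left_arm_enumerated:
  fixes x :: "nat \<Rightarrow> nat"
  assumes "1 \<le> p" "x ` {1..<p} \<subseteq> V"
    and "\<And>i. 1 \<le> i \<Longrightarrow> i < p \<Longrightarrow> x i < x (i + 1) \<and> A i (x i) \<noteq> A i (x (i + 1))"
  shows "arm (>) V (map A (rev [1..<p])) (x p) (x ` {1..<p})"
  using assms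
proof (induction p rule: dec_induct)
  case (step p)
  have "{1..<Suc p} = insert p {1..<p}" using step.hyps by auto
  moreover have "x p < x (Suc p)" "A p (x (Suc p)) \<noteq> A p (x p)"
    using step.prems(2)[of p] step.hyps by auto
  ultimately show ?case using step by force
qed simp

text \<open>
  Along the support of a circuit, equality of the signs of \<open>X\<close> at neighbours means that the row
  changes sign there; for a positive circuit all these equalities hold.
\<close>

lemma embracing_iff_enumeration:
  assumes "r \<le> n" "sign_matrix r n A" "e \<in> {1..n}"
  shows "embracing {1..n} (lawrence_circuits r n A) e B \<longleftrightarrow>
    B \<subseteq> {1..n} \<and> e \<notin> B \<and> (\<exists>x. strict_mono_on {1..r + 1} x \<and> x ` {1..r + 1} = insert e B \<and>
      (\<forall>i\<in>{1..r}. A i (x i) \<noteq> A i (x (i + 1))))"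
    (is "?emb \<longleftrightarrow> ?enum")
proof
  let ?C = "lawrence_circuits r n A"
  assume ?emb
  then have B: "is_basis {1..n} ?C B" "e \<notin> B"
    and pos: "fundamental_circuit ?C B e \<in> positive_circuits_at {1..n} ?C e"
    unfolding embracing_def by blast+
  define X where "X = fundamental_circuit ?C B e"
  have B': "B \<subseteq> {1..n}" "card B = r" using B(1) lawrence_basis_iff[OF assms(1)] by blast+
  have X: "X \<in> ?C" "supp X \<subseteq> B \<union> {e}"
    using theI'[OF lawrence_fundamental_circuit_ex1[OF assms(1) B(1) assms(3) B(2)]]
    unfolding X_def fundamental_circuit_def by blast+
  then obtain x where x: "strict_mono_on {1..r + 1} x" "supp X = x ` {1..r + 1}"
    "\<forall>i\<in>{1..r}. X (x i) = X (x (i + 1)) \<longleftrightarrow> A i (x i) = - A i (x (i + 1))"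
    unfolding lawrence_circuits_def by blast
  have fin: "finite B" using B'(1) finite_subset by blast
  have "card (supp X) = card (insert e B)"
    using x card_image[OF strict_mono_on_imp_inj_on[OF x(1)]] B' fin B(2) by simp
  then have sX: "supp X = insert e B" using X(2) fin card_subset_eq[of "insert e B" "supp X"] by auto
  have one: "X f = 1" if "f \<in> supp X" for f
  proof -
    have "f \<in> {1..n}" using that sX B'(1) assms(3) by auto
    then show ?thesis
      using pos that unfolding X_def[symmetric] positive_circuits_at_def supp_def by auto
  qed
  have "A i (x i) \<noteq> A i (x (i + 1))" if i: "i \<in> {1..r}" for i
  proof -
    have in_supp: "x i \<in> supp X" "x (i + 1) \<in> supp X" using x(2) i by auto
    then have "A i (x i) = - A i (x (i + 1))" using x(3) one i by auto
    moreover have "x i \<in> {1..n}" using in_supp(1) sX B'(1) assms(3) by auto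
    then have "A i (x i) \<noteq> 0" using assms(2) i unfolding sign_matrix_def by fastforce
    ultimately show ?thesis by linarith
  qed
  then show ?enum using x B' B(2) sX by auto
next
  let ?C = "lawrence_circuits r n A"
  assume ?enum
  then obtain x where B: "B \<subseteq> {1..n}" "e \<notin> B" and x: "strict_mono_on {1..r + 1} x"
    "x ` {1..r + 1} = insert e B" "\<forall>i\<in>{1..r}. A i (x i) \<noteq> A i (x (i + 1))" by blast
  have fin: "finite B" using B(1) finite_subset by blast
  have img: "x j \<in> insert e B" if "j \<in> {1..r + 1}" for j using x(2) that by blast
  have "card (insert e B) = r + 1"
    using x(2) card_image[OF strict_mono_on_imp_inj_on[OF x(1)]] by simp
  then have "card B = r" using fin B(2) by simp
  then have basis: "is_basis {1..n} ?C B" using lawrence_basis_iff[OF assms(1)] B(1) by blast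
  define X :: "nat \<Rightarrow> int" where "X f = (if f \<in> insert e B then 1 else 0)" for f
  have sX: "supp X = insert e B" by (auto simp: supp_def X_def)
  have "A i (x i) = - A i (x (i + 1))" if i: "i \<in> {1..r}" for i
  proof -
    have "x i \<in> insert e B" "x (i + 1) \<in> insert e B"
      using img[of i] img[of "i + 1"] i by auto
    then have "x i \<in> {1..n}" "x (i + 1) \<in> {1..n}" using B(1) assms(3)
      by (metis insert_iff subsetD)+
    then have "A i (x i) \<in> {1, -1}" "A i (x (i + 1)) \<in> {1, -1}"
      using assms(2) i unfolding sign_matrix_def by blast+
    moreover have "A i (x i) \<noteq> A i (x (i + 1))" using x(3) i by blast
    ultimately show ?thesis by auto
  qed
  moreover have "X (x i) = X (x (i + 1))" if "i \<in> {1..r}" for i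
  proof -
    have "x i \<in> insert e B" "x (i + 1) \<in> insert e B"
      using img[of i] img[of "i + 1"] that by auto
    then show ?thesis by (simp add: X_def)
  qed
  moreover have "signed_subset {1..n} X"
    using B(1) assms(3) by (auto simp: signed_subset_def X_def)
  ultimately have X: "X \<in> ?C" unfolding lawrence_circuits_def using x(1,2) sX by blast
  have "fundamental_circuit ?C B e = X"
    unfolding fundamental_circuit_def
    using lawrence_fundamental_circuit_ex1[OF assms(1) basis assms(3) B(2)]
    by (rule the1_equality) (use X sX in \<open>auto simp: X_def\<close>)
  then show ?emb
    using basis B(2) X by (auto simp: embracing_def positive_circuits_at_def X_def)
qed

lemma embracing_imp_arms:
  assumes "r \<le> n" "sign_matrix r n A" "e \<in> {1..n}"
    and "embracing {1..n} (lawrence_circuits r n A) e B"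
  obtains p S T where "1 \<le> p" "p \<le> r + 1" "left_arm n A p e S" "right_arm r n A p e T" "B = S \<union> T"
proof -
  obtain x where B: "B \<subseteq> {1..n}" "e \<notin> B" and x: "strict_mono_on {1..r + 1} x"
    "x ` {1..r + 1} = insert e B" "\<forall>i\<in>{1..r}. A i (x i) \<noteq> A i (x (i + 1))"
    using assms(4) unfolding embracing_iff_enumeration[OF assms(1-3)] by (elim conjE exE)
  have "e \<in> x ` {1..r + 1}" using x(2) by simp
  then obtain p where p: "e = x p" "1 \<le> p" "p \<le> r + 1" by auto
  have step: "x i < x (i + 1) \<and> A i (x i) \<noteq> A i (x (i + 1))" if "1 \<le> i" "i < r + 1" for i
    using that x(3) strict_mono_onD[OF x(1), of i "i + 1"] by auto
  have "x ` {1..r + 1} \<subseteq> {1..n}" using x(2) B(1) assms(3) by auto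
  then have V: "x ` {1..<p} \<subseteq> {1..n}" "x ` {p<..r + 1} \<subseteq> {1..n}" using p by fastforce+
  have "left_arm n A p e (x ` {1..<p})"
    unfolding p(1) using p V(1) step by (intro left_arm_enumerated) auto
  moreover have "right_arm r n A p e (x ` {p<..r + 1})"
    unfolding p(1) using p V(2) step by (intro right_arm_enumerated) auto
  moreover have "B = x ` {1..<p} \<union> x ` {p<..r + 1}"
  proof -
    have "{1..r + 1} - {p} = {1..<p} \<union> {p<..r + 1}" using p by auto
    moreover have "B = x ` ({1..r + 1} - {p})"
      using inj_on_image_set_diff[OF strict_mono_on_imp_inj_on[OF x(1)], of "{1..r + 1}" "{p}"]
        x(2) B(2) p by auto
    ultimately show ?thesis by (simp add: image_Un)
  qed
  ultimately show ?thesis using that p(2,3) by blast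
qed

lemma arms_imp_embracing:
  assumes "r \<le> n" "sign_matrix r n A" "e \<in> {1..n}"
    and "1 \<le> p" "p \<le> r + 1" and S: "left_arm n A p e S" and T: "right_arm r n A p e T"
  shows "embracing {1..n} (lawrence_circuits r n A) e (S \<union> T)"
proof -
  have rows: "rev (map A (rev [1..<p])) @ map A [p..<r + 1] = map A [1..<r + 1]"
    using upt_add_eq_append[OF assms(4), of "r + 1 - p"] assms(5)
    by (simp add: rev_map flip: map_append del: upt_Suc)
  obtain z U where U: "arm (<) {1..n} (map A [1..<r + 1]) z U" "insert z U = insert e (S \<union> T)"
    using arm_join[OF S T assms(3)] unfolding rows by blast
  obtain x where x: "x ` {..r} = insert e (S \<union> T)"
    "\<forall>i<r. x i < x (Suc i) \<and> A (i + 1) (x i) \<noteq> A (i + 1) (x (Suc i))"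
    using arm_enumeration[OF U(1)] U(2) by (auto simp del: upt_Suc)
  have mono: "x i < x j" if "i < j" "j \<le> r" for i j
    using that
  proof (induction j)
    case (Suc j)
    then show ?case using x(2) less_trans[of "x i" "x j" "x (Suc j)"] by (cases "i = j") auto
  qed simp
  \<comment> \<open>\<open>x\<close> is enumerated from \<open>0\<close>, the matrix and the circuits from \<open>1\<close>.\<close>
  define x' where "x' i = x (i - 1)" for i
  have "x' ` {1..r + 1} = x ` ((\<lambda>i. i - 1) ` {1..r + 1})" by (simp add: x'_def image_image)
  also have "(\<lambda>i. i - 1) ` {1..r + 1} = {..r}"
    by (force simp: image_iff intro: bexI[of _ "Suc _"])
  finally have "x' ` {1..r + 1} = insert e (S \<union> T)" using x(1) by simp
  moreover have "strict_mono_on {1..r + 1} x'"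
    using mono by (auto simp: strict_mono_on_def x'_def)
  moreover have "A i (x' i) \<noteq> A i (x' (i + 1))" if "i \<in> {1..r}" for i
    using that x(2) by (cases i) (auto simp: x'_def)
  moreover have "S \<union> T \<subseteq> {1..n}" "e \<notin> S \<union> T"
    using arm_beyond[OF _ S] arm_beyond[OF _ T] by fastforce+
  ultimately show ?thesis using embracing_iff_enumeration[OF assms(1-3)] by blast
qed

section \<open>Handing rows over and the distance bound\<close>

text \<open>
  Given a right arm \<open>T\<close> that uses the rows from \<open>p\<close> on and a left arm \<open>S\<close> that uses the rows below
  \<open>q\<close>, shorten \<open>S\<close> point by point to an arm for the rows below \<open>p\<close>. Adding these points
  back in reverse order, while a point is dropped from the right arm each time, is a sequence of
  exchanges through embracing bases.
\<close>

lemma shift_within: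
  assumes "r \<le> n" "sign_matrix r n A" "e \<in> {1..n}"
    and "1 \<le> p" "p \<le> q" "q \<le> r + 1" and "left_arm n A q e S" and T: "right_arm r n A p e T"
  shows "\<exists>S' T'. left_arm n A p e S' \<and> right_arm r n A q e T' \<and>
    exchange_within (embracing {1..n} (lawrence_circuits r n A) e) (q - p) (S' \<union> T) (S \<union> T')"
  using assms(5,6,7)
proof (induction q arbitrary: S rule: dec_induct)
  case base
  then show ?case
    using T arms_imp_embracing[OF assms(1-4)] by (blast intro: exchange_within.refl)
next
  case (step q)
  have q: "1 \<le> q" "q < r + 1" using step.hyps step.prems assms(4) by auto
  have "left_arm n A (Suc q) e = arm (>) {1..n} (A q # map A (rev [1..<q])) e"
    using q by simp
  then obtain z S1 where S1: "left_arm n A q e S1" "z \<notin> S1" "S = insert z S1"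
    using arm_drop[of "(>)" "{1..n}" "A q" "map A (rev [1..<q])" e S] step.prems(2) by auto
  obtain S' T' where IH: "left_arm n A p e S'" "right_arm r n A q e T'"
    "exchange_within (embracing {1..n} (lawrence_circuits r n A) e) (q - p) (S' \<union> T) (S1 \<union> T')"
    using step.IH[OF _ S1(1)] q by auto
  have "right_arm r n A q e = arm (<) {1..n} (A q # map A [Suc q..<r + 1]) e"
    using q by (simp only: upt_conv_Cons list.map)
  then obtain w T1 where T1: "right_arm r n A (Suc q) e T1" "w \<notin> T1" "T' = insert w T1"
    using arm_drop[of "(<)" "{1..n}" "A q" "map A [Suc q..<r + 1]" e T'] IH(2) by auto
  have "f < e" if "f \<in> insert z S1" for f
    using arm_beyond[OF _ step.prems(2)] that S1(3) by fastforce
  moreover have "e < f" if "f \<in> insert w T1" for f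
    using arm_beyond[OF _ IH(2)] that T1(3) by fastforce
  ultimately have "w \<notin> S1 \<union> T1" "z \<notin> S1 \<union> T1" "w \<noteq> z"
    using S1(2) T1(2) by (metis UnE insertCI not_less_iff_gr_or_eq)+
  then have "card (sym_diff (S1 \<union> T') (S \<union> T1)) = 2"
    unfolding S1(3) T1(3)
    using card_sym_diff_exchange[of w "S1 \<union> T1" z] by simp
  moreover have "embracing {1..n} (lawrence_circuits r n A) e (S \<union> T1)"
    using arms_imp_embracing[OF assms(1-3) _ _ step.prems(2) T1(1)] q by simp
  ultimately have "exchange_within (embracing {1..n} (lawrence_circuits r n A) e) (Suc (q - p))
      (S' \<union> T) (S \<union> T1)"
    using exchange_within.step[OF IH(3)] by blast
  then show ?case using IH(1) T1(1) Suc_diff_le[OF step.hyps(1)] by metis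
qed

lemma exchange_within_of_positions:
  assumes "r \<le> n" "sign_matrix r n A" "e \<in> {1..n}"
    and pq: "1 \<le> p" "p \<le> q" "q \<le> r + 1"
    and S: "left_arm n A p e S" and T: "right_arm r n A p e T"
    and S': "left_arm n A q e S'" and T': "right_arm r n A q e T'"
  shows "exchange_within (embracing {1..n} (lawrence_circuits r n A) e) r (S \<union> T) (S' \<union> T')"
proof -
  let ?emb = "embracing {1..n} (lawrence_circuits r n A) e"
  obtain S1 T1 where 1: "left_arm n A p e S1" "right_arm r n A q e T1"
    "exchange_within ?emb (q - p) (S1 \<union> T) (S' \<union> T1)"
    using shift_within[OF assms(1-3) pq S' T] by blast
  have disjoint: "L \<inter> R = {}" if "left_arm n A i e L" "right_arm r n A j e R" for i j L R
  proof -
    have "f < e" if "f \<in> L" for f using arm_beyond[OF _ \<open>left_arm n A i e L\<close> that] by auto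
    moreover have "e < f" if "f \<in> R" for f
      using arm_beyond[OF _ \<open>right_arm r n A j e R\<close> that] by auto
    ultimately show ?thesis by (metis disjoint_iff less_asym)
  qed
  have "exchange_within (left_arm n A p e) (p - 1) S S1"
    using arm_within[OF _ _ _ S 1(1)] by simp
  then have "exchange_within ?emb (p - 1) (S \<union> T) (S1 \<union> T)"
    by (rule exchange_within_Un) (use disjoint T arms_imp_embracing[OF assms(1-3)] pq in auto)
  moreover have "exchange_within (right_arm r n A q e) (r + 1 - q) T1 T'"
    using arm_within[OF _ _ _ 1(2) T'] by (simp del: upt_Suc)
  then have "exchange_within ?emb (r + 1 - q) (T1 \<union> S') (T' \<union> S')"
  proof (rule exchange_within_Un)
    fix R assume R: "right_arm r n A q e R"
    show "R \<inter> S' = {}" using disjoint[OF S' R] by blast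
    show "?emb (R \<union> S')"
      using arms_imp_embracing[OF assms(1-3) _ _ S' R] pq by (simp add: Un_commute)
  qed
  then have "exchange_within ?emb (r + 1 - q) (S' \<union> T1) (S' \<union> T')" by (simp add: Un_commute)
  ultimately have "exchange_within ?emb ((p - 1) + (q - p) + (r + 1 - q)) (S \<union> T) (S' \<union> T')"
    using 1(3) exchange_within_trans by metis
  moreover have "(p - 1) + (q - p) + (r + 1 - q) = r" using pq by simp
  ultimately show ?thesis by simp
qed

theorem theorem1p7:
  fixes r :: nat and E :: "nat set" and C :: "(nat \<Rightarrow> int) set"
    and e :: nat and B B' :: "nat set"
  assumes "lawrence_oriented_matroid r E C"
    and "e \<in> E"
    and "embracing E C e B"
    and "embracing E C e B'"
  shows "embracing_dist E C e B B' \<le> enat r"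
proof -
  obtain n A where nA: "r \<le> n" "sign_matrix r n A" and E: "E = {1..n}"
    and C: "C = lawrence_circuits r n A"
    using assms(1) unfolding lawrence_oriented_matroid_def by blast
  have e: "e \<in> {1..n}" using assms(2) E by simp
  obtain p S T where p: "1 \<le> p" "p \<le> r + 1" "left_arm n A p e S" "right_arm r n A p e T"
    "B = S \<union> T"
    using embracing_imp_arms[OF nA e] assms(3) E C by metis
  obtain q S' T' where q: "1 \<le> q" "q \<le> r + 1" "left_arm n A q e S'" "right_arm r n A q e T'"
    "B' = S' \<union> T'"
    using embracing_imp_arms[OF nA e] assms(4) E C by metis
  have "exchange_within (embracing E C e) r B B'"
  proof (cases "p \<le> q")
    case True
    then show ?thesis
      unfolding E C p(5) q(5) using exchange_within_of_positions[OF nA e p(1) _ q(2) p(3,4) q(3,4)] by simp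
  next
    case False
    then show ?thesis
      unfolding E C p(5) q(5)
      using exchange_within_sym[OF exchange_within_of_positions[OF nA e q(1) _ p(2) q(3,4) p(3,4)]] by simp
  qed
  then obtain j where "j \<le> r" "embracing_path E C e B B' j"
    using embracing_path_of_exchange_within[of E C e r B B'] by blast
  then have "embracing_dist E C e B B' \<le> enat j"
    unfolding embracing_dist_def by (intro Inf_lower) blast
  also have "\<dots> \<le> enat r" using \<open>j \<le> r\<close> by simp
  finally show ?thesis .
qed

end
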